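(* The constants $1/3$ and $1/4$ in the two inequalities $$\mathbb{E}\Bigl( |f_0| + \frac{1}{3}\sum_{n=1}^{N} \frac{|df_n|^2}{f^*_n}\Bigr) \leq \mathbb{E}( f^*_N ), \qquad \mathbb{E}\Bigl( |f_0| w_0 + \frac{1}{4}\sum_{n=1}^{N} \frac{|df_n|^2}{f^*_n} w_n\Bigr) \leq \mathbb{E}( f^*_N w^*_N )$$ (for Hilbert space valued martingales $(f_n)$, adapted sequences of weights $(w_n)$ and $N\in\mathbb{N}$) cannot be replaced by any larger constants. That is: (i) For every $c>1/3$ there exist a filtered probability space, a Hilbert space valued martingale $(f_n)_{n\in\mathbb{N}}$ on it, and $N\in\mathbb{N}$ such that $$\mathbb{E}\Bigl( |f_0| + c\sum_{n=1}^{N} \frac{|df_n|^2}{f^*_n}\Bigr) > \mathbb{E}( f^*_N ).$$ (ii) For every $c>1/4$ there exist a filtered probability space, a Hilbert space valued martingale $(f_n)_{n\in\mathbb{N}}$ on it, an adapted sequence of weights $(w_n)_{n\in\mathbb{N}}$ that is itself a (positive) martingale, and $N\in\mathbb{N}$ such that $$\mathbb{E}\Bigl( |f_0| w_0 + c\sum_{n=1}^{N} \frac{|df_n|^2}{f^*_n} w_n\Bigr) > \mathbb{E}( f^*_N w^*_N ).$$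
   Context: Here $\mathbb{N}=\{0,1,2,\dots\}$. A weight is a positive random variable on the underlying probability space; a sequence $(w_n)$ is adapted to the filtration $(\mathcal{F}_n)$ if $w_n$ is $\mathcal{F}_n$-measurable for every $n$. Notation: $df_n = f_n-f_{n-1}$ (for $n\geq 1$), $f^*_n := \max_{n'\leq n}|f_{n'}|$, $w^*_n := \max_{n'\leq n} w_{n'}$, where $|\cdot|$ is the Hilbert space norm. The quotient $|df_n|^2/f^*_n$ is interpreted as $0$ where $f^*_n=0$. *)

theory Defs
  imports "HOL-Probability.Probability"
begin

locale filtered_prob_space = prob_space M + filtration "space M" F
  for M :: "'a measure" and F :: "nat \<Rightarrow> 'a measure" +
  assumes subalgebra_F: "\<And>n. subalgebra M (F n)"

definition adapted ::
  "(nat \<Rightarrow> 'a measure) \<Rightarrow> (nat \<Rightarrow> 'a \<Rightarrow> 'b::topological_space) \<Rightarrow> bool" where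
  "adapted F f \<longleftrightarrow> (\<forall>n. f n \<in> borel_measurable (F n))"

text \<open>
  The constant \<open>real_cond_exp\<close> of the library covers only real-valued functions.  For functions
  with values in a Banach space, \<open>is_cond_exp M G f g\<close> says that \<open>g\<close> is a version of the
  conditional expectation of \<open>f\<close> given the sub-sigma-algebra \<open>G\<close>.
\<close>

definition is_cond_exp ::
  "'a measure \<Rightarrow> 'a measure \<Rightarrow> ('a \<Rightarrow> 'b) \<Rightarrow> ('a \<Rightarrow> 'b::{banach, second_countable_topology}) \<Rightarrow> bool"
where
  "is_cond_exp M G f g \<longleftrightarrow>
     integrable M f \<and> integrable M g \<and> g \<in> borel_measurable G \<and>
     (\<forall>A\<in>sets G. set_lebesgue_integral M A f = set_lebesgue_integral M A g)"

definition martingale ::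
  "'a measure \<Rightarrow> (nat \<Rightarrow> 'a measure) \<Rightarrow> (nat \<Rightarrow> 'a \<Rightarrow> 'b::{banach, second_countable_topology}) \<Rightarrow> bool"
where
  "martingale M F f \<longleftrightarrow>
     adapted F f \<and> (\<forall>n. integrable M (f n)) \<and>
     (\<forall>m n. m \<le> n \<longrightarrow> is_cond_exp M (F m) (f n) (f m))"

definition weight :: "'a measure \<Rightarrow> ('a \<Rightarrow> real) \<Rightarrow> bool" where
  "weight M w \<longleftrightarrow> w \<in> borel_measurable M \<and> (\<forall>x\<in>space M. 0 < w x)"

definition running_max :: "(nat \<Rightarrow> 'a \<Rightarrow> real) \<Rightarrow> nat \<Rightarrow> 'a \<Rightarrow> real" where
  "running_max w n x = Max ((\<lambda>k. w k x) ` {..n})"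

definition maximal_fn :: "(nat \<Rightarrow> 'a \<Rightarrow> 'h::real_normed_vector) \<Rightarrow> nat \<Rightarrow> 'a \<Rightarrow> real" where
  "maximal_fn f = running_max (\<lambda>n x. norm (f n x))"

definition mart_diff :: "(nat \<Rightarrow> 'a \<Rightarrow> 'h::real_normed_vector) \<Rightarrow> nat \<Rightarrow> 'a \<Rightarrow> 'h" where
  "mart_diff f n x = f n x - f (n - 1) x"

text \<open>Division by zero yields zero, as required where \<open>maximal_fn f n x = 0\<close>.\<close>

definition sq_quotient :: "(nat \<Rightarrow> 'a \<Rightarrow> 'h::real_normed_vector) \<Rightarrow> nat \<Rightarrow> 'a \<Rightarrow> real" where
  "sq_quotient f n x = (norm (mart_diff f n x))\<^sup>2 / maximal_fn f n x"

text \<open>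
  Expectation of a nonnegative random variable, with values in \<open>[0,\<infinity>]\<close>.  The Bochner integral would
  be zero on a nonintegrable function such as \<open>f\<^sup>* w\<^sup>*\<close> may be, and so would make a strict lower
  bound for the left-hand side too easy to satisfy.
\<close>

definition nn_expectation :: "'a measure \<Rightarrow> ('a \<Rightarrow> real) \<Rightarrow> ennreal" where
  "nn_expectation M X = (\<integral>\<^sup>+ x. ennreal (X x) \<partial>M)"

end

(* For both constants a single step of a real-valued martingale, multiplied by a unit vector,
   suffices.

   (i) Start at 1 and jump to -1 or to a large y > 1.  The two sides of the inequality differ by
   (y - 1) / (y + 1) * (c * (6 * y - 2) / y - 2), which is positive iff c > y / (3 * y - 1), and
   the latter tends to 1/3 as y grows.

   (ii) Start at f = w = 1 and let f jump to -1 with a small probability p, on which event w jumps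
   to W = 1 / (2 * p); otherwise w drops below 1 and f moves to (1 + p) / (1 - p), just above 1.
   The jump to -1 contributes 4 * c * p * W on the left, while the right-hand side is
   1 + p + p * W.  Hence (4 * c - 1) * W > 1 is enough. *)
theory Submission
  imports Defs
begin

text \<open>With the trivial sigma-algebra at time 0, the martingale property of a jump from a
  constant reduces to a condition on the mean.\<close>

definition one_step_filtration :: "'a measure \<Rightarrow> nat \<Rightarrow> 'a measure" where
  "one_step_filtration M n = (if n = 0 then sigma (space M) {} else M)"

definition one_step :: "'b \<Rightarrow> ('a \<Rightarrow> 'b) \<Rightarrow> nat \<Rightarrow> 'a \<Rightarrow> 'b" where
  "one_step a g n = (if n = 0 then (\<lambda>_. a) else g)"

lemma sets_sigma_empty: "sets (sigma S {}) = {{}, S}"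
  by (simp add: sigma_sets_empty_eq)

lemma filtered_prob_space_one_step:
  assumes "prob_space M"
  shows "filtered_prob_space M (one_step_filtration M)"
proof -
  interpret prob_space M by fact
  show ?thesis
    by unfold_locales
      (auto simp: one_step_filtration_def subalgebra_def sets_sigma_empty space_measure_of_conv)
qed

text \<open>The process does not move after time 1, so only the passage from time 0 to a later time
  needs an argument. There the test sets are the empty set and the whole space, and the latter gives
  exactly the condition that \<open>g\<close> has mean \<open>a\<close>.\<close>

lemma martingale_one_step:
  fixes g :: "'a \<Rightarrow> 'b::{banach, second_countable_topology}"
  assumes "prob_space M" and g: "integrable M g" and a: "integral\<^sup>L M g = a"
  shows "martingale M (one_step_filtration M) (one_step a g)"
proof -
  interpret prob_space M by fact
  have meas: "one_step a g n \<in> borel_measurable (one_step_filtration M n)" for n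
    using g by (auto simp: one_step_def one_step_filtration_def)
  have int: "integrable M (one_step a g n)" for n
    using g by (auto simp: one_step_def)
  have "is_cond_exp M (one_step_filtration M m) (one_step a g n) (one_step a g m)"
    if "m \<le> n" for m n
  proof (cases "m = 0 \<and> n \<noteq> 0")
    case True
    have "set_lebesgue_integral M (space M) g = set_lebesgue_integral M (space M) (\<lambda>_. a)"
      using g a by (simp add: set_integral_space prob_space)
    moreover have "set_lebesgue_integral M {} g = set_lebesgue_integral M {} (\<lambda>_. a)"
      by (simp add: set_lebesgue_integral_def)
    ultimately show ?thesis
      using True int[of n] int[of m] meas[of m]
      by (auto simp: is_cond_exp_def one_step_def one_step_filtration_def sets_sigma_empty)
  next
    case False
    then have "one_step a g n = one_step a g m"
      using that by (auto simp: one_step_def)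
    then show ?thesis
      using int meas by (simp add: is_cond_exp_def)
  qed
  then show ?thesis
    using meas int by (simp add: martingale_def adapted_def)
qed

text \<open>For \<open>p\<close> in [0,1] the mass is \<open>p\<close> at 1 and \<open>1 - p\<close>
  at 0. Every set of reals is measurable, and the finite support makes every function
  integrable.\<close>

definition coin :: "real \<Rightarrow> real measure" where
  "coin p = measure_pmf (map_pmf of_bool (bernoulli_pmf p))"

lemma prob_space_coin: "prob_space (coin p)"
  by (simp add: coin_def measure_pmf.prob_space_axioms)

lemma measurable_coin: "X \<in> borel_measurable (coin p)"
  by (simp add: coin_def)

lemma integrable_coin:
  fixes X :: "real \<Rightarrow> 'b::{banach, second_countable_topology}"
  shows "integrable (coin p) X"
  unfolding coin_def by (intro integrable_measure_pmf_finite) simp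

lemma integral_coin:
  fixes X :: "real \<Rightarrow> 'b::{banach, second_countable_topology}"
  assumes "0 \<le> p" "p \<le> 1"
  shows "integral\<^sup>L (coin p) X = p *\<^sub>R X 1 + (1 - p) *\<^sub>R X 0"
  using assms by (simp add: coin_def integral_measure_pmf[where A = UNIV] UNIV_bool)

lemma nn_expectation_coin:
  assumes "0 \<le> p" "p \<le> 1" and "\<And>x. 0 \<le> X x"
  shows "nn_expectation (coin p) X = ennreal (p * X 1 + (1 - p) * X 0)"
  unfolding nn_expectation_def
  using assms by (subst nn_integral_eq_integral) (auto simp: integrable_coin integral_coin)

lemma martingale_one_step_coin:
  fixes g :: "real \<Rightarrow> 'b::{banach, second_countable_topology}"
  assumes "0 \<le> p" "p \<le> 1" and "p *\<^sub>R g 1 + (1 - p) *\<^sub>R g 0 = a"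
  shows "martingale (coin p) (one_step_filtration (coin p)) (one_step a g)"
  using assms by (intro martingale_one_step prob_space_coin integrable_coin) (simp add: integral_coin)

lemma running_max_one_step:
  "running_max (one_step a g) 1 x = max a (g x)"
  by (simp add: running_max_def one_step_def atMost_Suc max.commute)

lemma maximal_fn_one_step:
  "maximal_fn (one_step a g) 1 x = max (norm a) (norm (g x))"
  by (simp add: maximal_fn_def running_max_def one_step_def atMost_Suc max.commute)

lemma sq_quotient_one_step:
  "sq_quotient (one_step a g) 1 x = (norm (g x - a))\<^sup>2 / max (norm a) (norm (g x))"
  unfolding sq_quotient_def maximal_fn_one_step by (simp add: mart_diff_def one_step_def)

lemma unweighted_sharp:
  fixes e :: "'h::{real_inner, banach, second_countable_topology}" and c :: real
  assumes e: "norm e = 1" and c: "c > 1/3"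
  shows "\<exists>(M :: real measure) F (f :: nat \<Rightarrow> real \<Rightarrow> 'h) N.
    filtered_prob_space M F \<and> martingale M F f \<and>
    nn_expectation M (\<lambda>x. norm (f 0 x) + c * (\<Sum>n=1..N. sq_quotient f n x))
      > nn_expectation M (maximal_fn f N)"
proof -
  \<comment> \<open>The aim is y > c / (3 * c - 1), which is \<open>cy\<close> rearranged; the
    summand 2 makes this strict and gives y > 1 as well.\<close>
  define y where "y = 2 + c / (3 * c - 1)"
  have "c / (3 * c - 1) > 0"
    using c by simp
  then have y: "y > 1"
    by (simp add: y_def)
  have "(3 * c - 1) * y = 2 * (3 * c - 1) + c"
    using c by (simp add: y_def distrib_left)
  with c have cy: "y < c * (3 * y - 1)"
    by (simp add: algebra_simps)
  \<comment> \<open>The probability of the jump up to \<open>y\<close>, forced by the mean: p * y -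
    (1 - p) = 1.\<close>
  define p where "p = 2 / (1 + y)"
  have p: "0 \<le> p" "p \<le> 1" and q: "1 - p = (y - 1) / (1 + y)"
    using y by (auto simp: p_def field_simps)
  \<comment> \<open>The else branch gives the value at 0 and also fills the null set off {0, 1}, so
    that the identities below hold at every real.\<close>
  define g where "g x = (if x = 1 then y else -1) *\<^sub>R e" for x :: real
  define f where "f = one_step e g"
  have "p *\<^sub>R g 1 + (1 - p) *\<^sub>R g 0 = (p * y - (1 - p)) *\<^sub>R e"
    by (simp add: g_def scaleR_diff_left)
  also have "p * y - (1 - p) = 1"
    using y by (simp add: q p_def divide_simps)
  finally have mart: "martingale (coin p) (one_step_filtration (coin p)) f"
    unfolding f_def using p by (intro martingale_one_step_coin) auto
  have mx: "maximal_fn f 1 x = (if x = 1 then y else 1)" for x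
    using y e by (simp add: f_def maximal_fn_one_step[unfolded One_nat_def] g_def)
  \<comment> \<open>The instance at -1 and 1 evaluates the jump down, -e - e.\<close>
  have "g x - e = (if x = 1 then y - 1 else -2) *\<^sub>R e" for x
    using scaleR_left_diff_distrib[of "-1" 1 e] by (simp add: g_def scaleR_left_diff_distrib)
  \<comment> \<open>The jump to -1 has length 2 but leaves the maximal function at 1, hence the
    value 4.\<close>
  then have sq: "sq_quotient f 1 x = (if x = 1 then (y - 1)\<^sup>2 / y else 4)" for x
    using y e by (simp add: f_def sq_quotient_one_step[unfolded One_nat_def] g_def)
  have f0: "norm (f 0 x) = 1" for x
    using e by (simp add: f_def one_step_def)
  have rhs: "nn_expectation (coin p) (maximal_fn f 1) = ennreal (p * y + (1 - p))"
    using p y by (subst nn_expectation_coin) (auto simp: mx simp del: One_nat_def)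
  have lhs: "nn_expectation (coin p) (\<lambda>x. norm (f 0 x) + c * (\<Sum>n=1..1. sq_quotient f n x))
      = ennreal (p * (1 + c * ((y - 1)\<^sup>2 / y)) + (1 - p) * (1 + c * 4))"
    using p y c by (subst nn_expectation_coin) (auto simp: f0 sq simp del: One_nat_def)
  \<comment> \<open>The factor pulled out is positive for y > 1, which leaves the sign to
    \<open>cy\<close>.\<close>
  have "p * (1 + c * ((y - 1)\<^sup>2 / y)) + (1 - p) * (1 + c * 4) - (p * y + (1 - p))
      = 2 * (y - 1) / (y * (1 + y)) * (c * (3 * y - 1) - y)"
    using y unfolding q p_def by (simp add: divide_simps) algebra
  also have "\<dots> > 0"
    using y cy by simp
  finally have "p * y + (1 - p) < p * (1 + c * ((y - 1)\<^sup>2 / y)) + (1 - p) * (1 + c * 4)"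
    by simp
  \<comment> \<open>Since \<open>ennreal\<close> truncates negative reals to 0, strictness survives
    only if the larger side is positive.\<close>
  then have "nn_expectation (coin p) (maximal_fn f 1)
      < nn_expectation (coin p) (\<lambda>x. norm (f 0 x) + c * (\<Sum>n=1..1. sq_quotient f n x))"
    unfolding lhs rhs using p y by (intro ennreal_lessI) (auto intro: le_less_trans[rotated])
  with mart filtered_prob_space_one_step[OF prob_space_coin] show ?thesis
    by blast
qed

lemma weighted_sharp:
  fixes e :: "'h::{real_inner, banach, second_countable_topology}" and c :: real
  assumes e: "norm e = 1" and c: "c > 1/4"
  shows "\<exists>(M :: real measure) F (f :: nat \<Rightarrow> real \<Rightarrow> 'h) (w :: nat \<Rightarrow> real \<Rightarrow> real) N.
    filtered_prob_space M F \<and> martingale M F f \<and>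
    (\<forall>n. weight M (w n)) \<and> adapted F w \<and> martingale M F w \<and>
    nn_expectation M (\<lambda>x. norm (f 0 x) * w 0 x + c * (\<Sum>n=1..N. sq_quotient f n x * w n x))
      > nn_expectation M (\<lambda>x. maximal_fn f N x * running_max w N x)"
proof -
  \<comment> \<open>Chosen so that (4 * c - 1) * W exceeds 1 and W > 1, the latter for p <
    1/2.\<close>
  define W where "W = 2 + 1 / (4 * c - 1)"
  have "1 / (4 * c - 1) > 0"
    using c by simp
  then have W: "W > 1"
    unfolding W_def by linarith
  have cW: "1 < (4 * c - 1) * W"
    using c by (simp add: W_def distrib_left)
  \<comment> \<open>The rare event carries exactly half of the mean of the weight.\<close>
  define p where "p = 1 / (2 * W)"
  have p: "0 < p" "p < 1/2" and pW: "p * W = 1/2"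
    using W by (auto simp: p_def field_simps)
  \<comment> \<open>Forced by the mean of \<open>f\<close>: (1 - p) * y - p = 1.\<close>
  define y where "y = (1 + p) / (1 - p)"
  have y: "y > 1" and py: "(1 - p) * y = 1 + p"
    using p by (auto simp: y_def field_simps)
  \<comment> \<open>The other half of the mean of the weight, spread over the likely event. As p <
    1/2, it lies below 1, so the running maximum of \<open>w\<close> stays at 1 there.\<close>
  define h where "h = 1 / (2 * (1 - p))"
  have h: "0 < h" "h < 1" and ph: "(1 - p) * h = 1/2"
    using p by (auto simp: h_def field_simps)
  define g where "g x = (if x = 1 then -1 else y) *\<^sub>R e" for x :: real
  define v where "v x = (if x = 1 then W else h)" for x :: real
  define f where "f = one_step e g"
  define w where "w = one_step 1 v"
  have "p *\<^sub>R g 1 + (1 - p) *\<^sub>R g 0 = ((1 - p) * y - p) *\<^sub>R e"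
    by (simp add: g_def scaleR_diff_left)
  then have mart_f: "martingale (coin p) (one_step_filtration (coin p)) f"
    unfolding f_def using p py by (intro martingale_one_step_coin) auto
  have mart_w: "martingale (coin p) (one_step_filtration (coin p)) w"
    unfolding w_def using p pW ph by (intro martingale_one_step_coin) (auto simp: v_def)
  then have adapted_w: "adapted (one_step_filtration (coin p)) w"
    by (simp add: martingale_def)
  have weight_w: "weight (coin p) (w n)" for n
    using W h by (simp add: weight_def measurable_coin w_def one_step_def v_def)
  have w1: "w 1 = v"
    by (simp add: w_def one_step_def)
  have mx: "maximal_fn f 1 x = (if x = 1 then 1 else y)" for x
    using y e by (simp add: f_def maximal_fn_one_step[unfolded One_nat_def] g_def)
  have rm: "running_max w 1 x = (if x = 1 then W else 1)" for x
    using W h by (simp add: w_def running_max_one_step[unfolded One_nat_def] v_def)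
  have "g x - e = (if x = 1 then -2 else y - 1) *\<^sub>R e" for x
    using scaleR_left_diff_distrib[of "-1" 1 e] by (simp add: g_def scaleR_left_diff_distrib)
  then have sq: "sq_quotient f 1 x = (if x = 1 then 4 else (y - 1)\<^sup>2 / y)" for x
    using y e by (simp add: f_def sq_quotient_one_step[unfolded One_nat_def] g_def)
  have f0: "norm (f 0 x) * w 0 x = 1" for x
    using e by (simp add: f_def w_def one_step_def)
  have rhs: "nn_expectation (coin p) (\<lambda>x. maximal_fn f 1 x * running_max w 1 x)
      = ennreal (p * W + (1 - p) * y)"
    using p y W by (subst nn_expectation_coin) (auto simp: mx rm simp del: One_nat_def)
  have lhs: "nn_expectation (coin p)
        (\<lambda>x. norm (f 0 x) * w 0 x + c * (\<Sum>n=1..1. sq_quotient f n x * w n x))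
      = ennreal (p * (1 + c * (4 * W)) + (1 - p) * (1 + c * ((y - 1)\<^sup>2 / y * h)))"
    using p y c W h
    by (subst nn_expectation_coin) (auto simp: f0 sq w1 v_def simp del: One_nat_def)
  \<comment> \<open>The summand \<open>p * 1\<close> is the price of the drift to \<open>y\<close>
    that balances the jump to -1; by \<open>cW\<close> the surplus of that jump's quotient outweighs
    it. The last step discards the nonnegative quotient of the small jump to
    \<open>y\<close>.\<close>
  have "p * W + (1 - p) * y = p * W + p * 1 + 1"
    by (simp add: py)
  also have "\<dots> < p * W + p * ((4 * c - 1) * W) + 1"
    using p cW by simp
  also have "\<dots> = p * (1 + c * (4 * W)) + (1 - p)"
    by (simp add: algebra_simps)
  also have "\<dots> \<le> p * (1 + c * (4 * W)) + (1 - p) * (1 + c * ((y - 1)\<^sup>2 / y * h))"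
    using p y c h by simp
  finally have less: "p * W + (1 - p) * y
      < p * (1 + c * (4 * W)) + (1 - p) * (1 + c * ((y - 1)\<^sup>2 / y * h))" .
  moreover have "0 \<le> p * W + (1 - p) * y"
    by (simp add: pW py) (use p in simp)
  ultimately have "nn_expectation (coin p) (\<lambda>x. maximal_fn f 1 x * running_max w 1 x)
      < nn_expectation (coin p)
          (\<lambda>x. norm (f 0 x) * w 0 x + c * (\<Sum>n=1..1. sq_quotient f n x * w n x))"
    unfolding lhs rhs by (intro ennreal_lessI) auto
  with mart_f mart_w adapted_w weight_w filtered_prob_space_one_step[OF prob_space_coin]
  show ?thesis
    by blast
qed

theorem mainTheorem3:
  assumes "\<exists>v :: 'h::{real_inner, banach, second_countable_topology}. v \<noteq> 0"
  shows "(\<forall>c::real. c > 1/3 \<longrightarrow>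
      (\<exists>(M :: real measure) (F :: nat \<Rightarrow> real measure) (f :: nat \<Rightarrow> real \<Rightarrow> 'h) (N :: nat).
         filtered_prob_space M F \<and> martingale M F f \<and>
         nn_expectation M (\<lambda>x. norm (f 0 x) + c * (\<Sum>n=1..N. sq_quotient f n x))
           > nn_expectation M (maximal_fn f N)))
    \<and> (\<forall>c::real. c > 1/4 \<longrightarrow>
      (\<exists>(M :: real measure) (F :: nat \<Rightarrow> real measure) (f :: nat \<Rightarrow> real \<Rightarrow> 'h)
          (w :: nat \<Rightarrow> real \<Rightarrow> real) (N :: nat).
         filtered_prob_space M F \<and> martingale M F f \<and>
         (\<forall>n. weight M (w n)) \<and> adapted F w \<and> martingale M F w \<and>
         nn_expectation M (\<lambda>x. norm (f 0 x) * w 0 x + c * (\<Sum>n=1..N. sq_quotient f n x * w n x))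
           > nn_expectation M (\<lambda>x. maximal_fn f N x * running_max w N x)))"
proof -
  from assms obtain v :: 'h where "v \<noteq> 0"
    by blast
  then have "norm (sgn v) = 1"
    by (simp add: norm_sgn)
  then show ?thesis
    using unweighted_sharp[of "sgn v"] weighted_sharp[of "sgn v"] by blast
qed

end
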